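(* Let $\mathbf{d}$ be a distance on a set $X$ such that $X$ is $\mathbf{d}^\bullet_\circ$-continuous. Then $$\underline{\mathbf{d}_+^{\mathcal{H}}|_{\mathcal{P}_0^{\mathbf{d}}(X)}}=\mathbf{d}_{+\mathcal{H}}|_{\mathcal{P}_0^{\mathbf{d}}(X)}.$$ Moreover, $\mathcal{P}_0^{\mathbf{d}}(X)$ is a $\mathbf{d}_+^{\mathcal{H}}{}^\bullet_\circ$-domain with $\mathbf{d}_+^{\mathcal{H}}{}^\bullet_\circ$-basis $(x_0)_{x\in X}$, and for all $x,y\in X$, $$x_0\,\mathbf{d}_+^{\mathcal{H}}\,y_0\leq x\mathbf{d}y.$$
   Context: Suprema and infima are taken in $[0,\infty]$, with $\sup\emptyset=0$, $\inf\emptyset=\infty$; for $a,b\in[0,\infty]$, $(a-b)_+=\min\{c\in[0,\infty]:a\leq b+c\}$; for real $r$, $r_+=\max(r,0)$, and $\infty_+=\infty$. A distance on $X$ is a function $\mathbf{d}:X\times X\to[0,\infty]$, written $x\mathbf{d}y$, with $x\mathbf{d}z\leq x\mathbf{d}y+y\mathbf{d}z$ for all $x,y,z$ (no symmetry, and $x\mathbf{d}x=0$ is not required). Functions are ordered pointwise. The upper and lower hemimetrics are $x\overline{\mathbf{d}}z=\sup_{y\in X}(x\mathbf{d}y-z\mathbf{d}y)_+$ and $z\underline{\mathbf{d}}y=\sup_{x\in X}(x\mathbf{d}y-x\mathbf{d}z)_+$; for a function restricted to a smaller set, the suprema range only over that smaller set. A net is a family $(x_\lambda)_{\lambda\in\Lambda}$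 indexed by a non-empty set with a transitive (not necessarily reflexive) relation $\prec$ such that any two elements $\gamma,\delta$ have some $\lambda$ with $\gamma,\delta\prec\lambda$; limits are taken along $\prec$. It is $\mathbf{d}$-Cauchy if $\lim_\gamma\sup_{\gamma\prec\delta}x_\gamma\mathbf{d}x_\delta=0$. The Smyth topology $\mathbf{d}^\bullet_\circ$ is generated by the sets $\{x:c\mathbf{d}x<r\}$ and $\{x:c\mathbf{d}x>r\}$ ($c\in X$, $r$ real). $X$ is $\mathbf{d}^\bullet_\circ$-complete if every $\mathbf{d}$-Cauchy net in $X$ has a $\mathbf{d}^\bullet_\circ$-limit in $X$. $B\subseteq X$ is a $\mathbf{d}^\bullet_\circ$-basis of $X$ if every $x\in X$ is a $\mathbf{d}^\bullet_\circ$-limit of some $\mathbf{d}$-Cauchy net in $B$; $X$ is $\mathbf{d}^\bullet_\circ$-continuous if $X$ is a $\mathbf{d}^\bullet_\circ$-basis of itself. $X$ is a $\mathbf{d}^\bullet_\circ$-domain if it is $\mathbf{d}^\bullet_\circ$-complete, $\mathbf{d}^\bullet_\circ$-continuous and $\overline{\mathbf{d}}\leq\underline{\mathbf{d}}$. These notions apply to any distance on any set. Formal balls: $X_+=X\times[0,\infty)$ with the distance $(x,r)\mathbf{d}_+(y,s)=(x\mathbf{d}y-r+s)_+$. On subsets of $X_+$ define $Y\mathbf{d}_+^{\mathcal{H}}Z=\inf_{z\in Z}\sup_{y\in Y}y\mathbf{d}_+z$ and $Y\mathbf{d}_{+\mathcal{H}}Z=\sup_{y\in Y}\inf_{z\in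 Z}y\mathbf{d}_+z$; both are distances on $\mathcal{P}(X_+)$. $Y\subseteq X_+$ is $\mathbf{d}_+$-directed if $\inf_{y\in Y}\sup_{z\in F}z\mathbf{d}_+y=0$ for every finite $F\subseteq Y$ (so $Y\neq\emptyset$). The aperture of $Y\subseteq X_+$ is $\alpha(Y)=\inf_{(x,r)\in Y}r$, and $\mathcal{P}_0^{\mathbf{d}}(X)$ is the set of $\mathbf{d}_+$-directed $Y\subseteq X_+$ with $\alpha(Y)=0$. For $x\in X$, $x_0=\{(y,s)\in X_+:y\mathbf{d}x\leq s\}$. The assertion about $\mathcal{P}_0^{\mathbf{d}}(X)$ being a domain with a given basis refers to $\mathcal{P}_0^{\mathbf{d}}(X)$ with the restriction of the distance $\mathbf{d}_+^{\mathcal{H}}$ and its Smyth topology. *)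

theory Defs
  imports "HOL-Analysis.Analysis"
begin

text \<open>A distance lives on a carrier set \<open>X\<close> and takes values in \<open>ennreal\<close>; values outside
  \<open>X\<close> are irrelevant. In \<open>ennreal\<close>, as in the convention used here, \<open>Sup {} = 0\<close> and
  \<open>Inf {} = \<infinity>\<close>.\<close>

definition distance_on :: "'a set \<Rightarrow> ('a \<Rightarrow> 'a \<Rightarrow> ennreal) \<Rightarrow> bool" where
  "distance_on X d \<longleftrightarrow> (\<forall>x\<in>X. \<forall>y\<in>X. \<forall>z\<in>X. d x z \<le> d x y + d y z)"

text \<open>\<open>(a - b)\<^sub>+\<close>. This is not the subtraction of \<open>ennreal\<close>, for which \<open>\<infinity> - \<infinity> = \<infinity>\<close>:
  here \<open>pos_diff \<infinity> \<infinity> = 0\<close>. Lemma \<open>pos_diff_le_iff\<close> shows that the infimum is a minimum.\<close>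

definition pos_diff :: "ennreal \<Rightarrow> ennreal \<Rightarrow> ennreal" where
  "pos_diff a b = Inf {c. a \<le> b + c}"

lemma pos_diff_le_iff: "pos_diff a b \<le> c \<longleftrightarrow> a \<le> b + c"
proof
  assume "pos_diff a b \<le> c"
  show "a \<le> b + c"
  proof (cases "b = top")
    case False
    have "a - b \<le> pos_diff a b"
      unfolding pos_diff_def
      by (rule Inf_greatest) (use False in \<open>auto simp: ennreal_minus_le_iff\<close>)
    with \<open>pos_diff a b \<le> c\<close> have "a - b \<le> c" by simp
    then show ?thesis using False by (auto simp: ennreal_minus_le_iff)
  qed simp
next
  assume "a \<le> b + c"
  then show "pos_diff a b \<le> c"
    unfolding pos_diff_def by (intro Inf_lower) simp
qed

definition upper_hemimetric :: "'a set \<Rightarrow> ('a \<Rightarrow> 'a \<Rightarrow> ennreal) \<Rightarrow> 'a \<Rightarrow> 'a \<Rightarrow> ennreal" where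
  "upper_hemimetric X d x z = (SUP y\<in>X. pos_diff (d x y) (d z y))"

definition lower_hemimetric :: "'a set \<Rightarrow> ('a \<Rightarrow> 'a \<Rightarrow> ennreal) \<Rightarrow> 'a \<Rightarrow> 'a \<Rightarrow> ennreal" where
  "lower_hemimetric X d z y = (SUP x\<in>X. pos_diff (d x y) (d x z))"

definition net_index :: "'i set \<Rightarrow> ('i \<Rightarrow> 'i \<Rightarrow> bool) \<Rightarrow> bool" where
  "net_index \<Lambda> prec \<longleftrightarrow> \<Lambda> \<noteq> {} \<and>
     (\<forall>\<alpha>\<in>\<Lambda>. \<forall>\<beta>\<in>\<Lambda>. \<forall>\<gamma>\<in>\<Lambda>. prec \<alpha> \<beta> \<longrightarrow> prec \<beta> \<gamma> \<longrightarrow> prec \<alpha> \<gamma>) \<and>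
     (\<forall>\<gamma>\<in>\<Lambda>. \<forall>\<delta>\<in>\<Lambda>. \<exists>l\<in>\<Lambda>. prec \<gamma> l \<and> prec \<delta> l)"

text \<open>Limits along \<open>prec\<close> are limits along the filter generated by the tails.\<close>

definition tails :: "'i set \<Rightarrow> ('i \<Rightarrow> 'i \<Rightarrow> bool) \<Rightarrow> 'i filter" where
  "tails \<Lambda> prec = (INF \<gamma>\<in>\<Lambda>. principal {\<delta>\<in>\<Lambda>. prec \<gamma> \<delta>})"

lemma eventually_tails:
  assumes "net_index \<Lambda> prec"
  shows "eventually P (tails \<Lambda> prec) \<longleftrightarrow> (\<exists>\<gamma>\<in>\<Lambda>. \<forall>\<delta>\<in>\<Lambda>. prec \<gamma> \<delta> \<longrightarrow> P \<delta>)"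
proof -
  have "eventually P (tails \<Lambda> prec) \<longleftrightarrow>
      (\<exists>\<gamma>\<in>\<Lambda>. eventually P (principal {\<delta>\<in>\<Lambda>. prec \<gamma> \<delta>}))"
    unfolding tails_def
  proof (rule eventually_INF_base)
    show "\<Lambda> \<noteq> {}" using assms by (simp add: net_index_def)
  next
    fix a b assume ab: "a \<in> \<Lambda>" "b \<in> \<Lambda>"
    then obtain l where l: "l \<in> \<Lambda>" "prec a l" "prec b l"
      using assms unfolding net_index_def by blast
    have "{\<delta>\<in>\<Lambda>. prec l \<delta>} \<subseteq> {\<delta>\<in>\<Lambda>. prec a \<delta>} \<inter> {\<delta>\<in>\<Lambda>. prec b \<delta>}"
      using assms ab l unfolding net_index_def by blast
    then show "\<exists>x\<in>\<Lambda>. principal {\<delta>\<in>\<Lambda>. prec x \<delta>} \<le>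
        inf (principal {\<delta>\<in>\<Lambda>. prec a \<delta>}) (principal {\<delta>\<in>\<Lambda>. prec b \<delta>})"
      using l(1) by auto
  qed
  then show ?thesis by (auto simp: eventually_principal)
qed

definition cauchy_net ::
    "('a \<Rightarrow> 'a \<Rightarrow> ennreal) \<Rightarrow> 'i set \<Rightarrow> ('i \<Rightarrow> 'i \<Rightarrow> bool) \<Rightarrow> ('i \<Rightarrow> 'a) \<Rightarrow> bool" where
  "cauchy_net d \<Lambda> prec x \<longleftrightarrow> net_index \<Lambda> prec \<and>
     ((\<lambda>\<gamma>. SUP \<delta>\<in>{\<delta>\<in>\<Lambda>. prec \<gamma> \<delta>}. d (x \<gamma>) (x \<delta>)) \<longlongrightarrow> 0) (tails \<Lambda> prec)"

definition smyth_topology :: "'a set \<Rightarrow> ('a \<Rightarrow> 'a \<Rightarrow> ennreal) \<Rightarrow> 'a topology" where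
  "smyth_topology X d = topology_generated_by
     ({{x\<in>X. enn2ereal (d c x) < ereal r} | c r. c \<in> X} \<union>
      {{x\<in>X. enn2ereal (d c x) > ereal r} | c r. c \<in> X})"

text \<open>The subbasic sets \<open>{x \<in> X. d c x > r}\<close> with \<open>r < 0\<close> are all of \<open>X\<close>, so that the
  generated topology is a topology on \<open>X\<close>.\<close>

lemma topspace_smyth_topology: "topspace (smyth_topology X d) = X"
proof -
  have "x \<in> {x\<in>X. enn2ereal (d c x) > ereal (- 1)}" if "x \<in> X" for c x
  proof -
    have "ereal (- 1) < 0" by simp
    also have "0 \<le> enn2ereal (d c x)" by simp
    finally show ?thesis using that by simp
  qed
  then show ?thesis
    unfolding smyth_topology_def topology_generated_by_topspace by blast
qed

text \<open>The notions below quantify over nets, hence over index sets. Index sets are subsets of a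
  type \<open>'i\<close>, which is an explicit parameter because types cannot be quantified inside a formula.
  For an assumption that nets exist, and for a conclusion about all nets, a type variable \<open>'i\<close>
  amounts to arbitrary index sets; a conclusion that nets exist names a concrete index type.
  Accordingly \<open>smyth_domain\<close> has separate parameters for completeness and for continuity.\<close>

definition smyth_complete :: "'i itself \<Rightarrow> 'a set \<Rightarrow> ('a \<Rightarrow> 'a \<Rightarrow> ennreal) \<Rightarrow> bool" where
  "smyth_complete (_ :: 'i itself) X d \<longleftrightarrow>
     (\<forall>(\<Lambda> :: 'i set) prec x. x ` \<Lambda> \<subseteq> X \<and> cauchy_net d \<Lambda> prec x \<longrightarrow>
        (\<exists>l\<in>X. limitin (smyth_topology X d) x l (tails \<Lambda> prec)))"

definition smyth_basis :: "'i itself \<Rightarrow> 'a set \<Rightarrow> 'a set \<Rightarrow> ('a \<Rightarrow> 'a \<Rightarrow> ennreal) \<Rightarrow> bool" where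
  "smyth_basis (_ :: 'i itself) B X d \<longleftrightarrow> B \<subseteq> X \<and>
     (\<forall>l\<in>X. \<exists>(\<Lambda> :: 'i set) prec x. x ` \<Lambda> \<subseteq> B \<and> cauchy_net d \<Lambda> prec x \<and>
        limitin (smyth_topology X d) x l (tails \<Lambda> prec))"

definition smyth_continuous :: "'i itself \<Rightarrow> 'a set \<Rightarrow> ('a \<Rightarrow> 'a \<Rightarrow> ennreal) \<Rightarrow> bool" where
  "smyth_continuous I X d \<longleftrightarrow> smyth_basis I X X d"

definition smyth_domain ::
    "'j itself \<Rightarrow> 'k itself \<Rightarrow> 'a set \<Rightarrow> ('a \<Rightarrow> 'a \<Rightarrow> ennreal) \<Rightarrow> bool" where
  "smyth_domain J K X d \<longleftrightarrow> smyth_complete J X d \<and> smyth_continuous K X d \<and>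
     (\<forall>x\<in>X. \<forall>y\<in>X. upper_hemimetric X d x y \<le> lower_hemimetric X d x y)"

definition formal_balls :: "'a set \<Rightarrow> ('a \<times> real) set" where
  "formal_balls X = X \<times> {0..}"

text \<open>As \<open>r\<close> is finite, the truncated subtraction of \<open>ennreal\<close> gives \<open>(d x y - r + s)\<^sub>+\<close>, also
  when \<open>d x y = \<infinity>\<close>.\<close>

definition ball_dist ::
    "('a \<Rightarrow> 'a \<Rightarrow> ennreal) \<Rightarrow> 'a \<times> real \<Rightarrow> 'a \<times> real \<Rightarrow> ennreal" where
  "ball_dist d = (\<lambda>(x, r) (y, s). (d x y + ennreal s) - ennreal r)"

text \<open>For \<open>D = ball_dist d\<close>: the distance with superscript \<open>\<H>\<close>, then the one with subscript
  \<open>\<H>\<close>.\<close>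

definition hausdorff_sup :: "('b \<Rightarrow> 'b \<Rightarrow> ennreal) \<Rightarrow> 'b set \<Rightarrow> 'b set \<Rightarrow> ennreal" where
  "hausdorff_sup D Y Z = (INF z\<in>Z. SUP y\<in>Y. D y z)"

definition hausdorff_sub :: "('b \<Rightarrow> 'b \<Rightarrow> ennreal) \<Rightarrow> 'b set \<Rightarrow> 'b set \<Rightarrow> ennreal" where
  "hausdorff_sub D Y Z = (SUP y\<in>Y. INF z\<in>Z. D y z)"

definition directed_for :: "('b \<Rightarrow> 'b \<Rightarrow> ennreal) \<Rightarrow> 'b set \<Rightarrow> bool" where
  "directed_for D Y \<longleftrightarrow> (\<forall>F. finite F \<and> F \<subseteq> Y \<longrightarrow> (INF y\<in>Y. SUP z\<in>F. D z y) = 0)"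

definition aperture :: "('a \<times> real) set \<Rightarrow> ennreal" where
  "aperture Y = (INF (x, r)\<in>Y. ennreal r)"

definition directed_balls_0 :: "'a set \<Rightarrow> ('a \<Rightarrow> 'a \<Rightarrow> ennreal) \<Rightarrow> ('a \<times> real) set set" where
  "directed_balls_0 X d =
     {Y. Y \<subseteq> formal_balls X \<and> directed_for (ball_dist d) Y \<and> aperture Y = 0}"

text \<open>The set written \<open>x\<^sub>0\<close>.\<close>

definition ball_ideal :: "'a set \<Rightarrow> ('a \<Rightarrow> 'a \<Rightarrow> ennreal) \<Rightarrow> 'a \<Rightarrow> ('a \<times> real) set" where
  "ball_ideal X d x = {(y, s) \<in> formal_balls X. d y x \<le> ennreal s}"

end

theory Submission
  imports Defs
begin

text \<open>
  Write \<open>D\<close> for the distance \<open>ball_dist d\<close> on formal balls, \<open>H\<close> for \<open>hausdorff_sup D\<close> and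
  \<open>h\<close> for \<open>hausdorff_sub D\<close>.

  Continuity of \<open>X\<close> enters through one consequence only, the assumption of the locale
  \<open>approximable_distance\<close>: a point \<open>x\<close> can be approximated by points \<open>z\<close> with \<open>d z x\<close> arbitrarily
  small and with \<open>d c z\<close> hardly larger than \<open>d c x\<close>, for finitely many \<open>c\<close> at a time. This makes
  \<open>x\<^sub>0\<close> a directed set of balls of aperture \<open>0\<close>, and gives \<open>H x\<^sub>0 y\<^sub>0 \<le> d x y\<close>.

  The Hausdorff distances satisfy two mixed triangle inequalities, \<open>H C Z \<le> H C Y + h Y Z\<close> and
  \<open>H Y C \<le> h Y Z + H Z C\<close>. They bound the lower and the upper hemimetric of \<open>H\<close> by \<open>h\<close>. That the
  lower hemimetric is at least \<open>h\<close> is tested on the sets \<open>x\<^sub>0\<close>, using \<open>H x\<^sub>0 Y \<le> r\<close> for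
  \<open>(x, r) \<in> Y\<close>. A ball \<open>(x, r)\<close> of \<open>Y\<close> has to be replaced here by a nearby ball \<open>(x', r')\<close> of \<open>Y\<close>, as
  \<open>d x z\<close> need not be small for \<open>z\<close> approximating \<open>x\<close>.

  Both limits that have to be constructed come from one criterion, \<open>hausdorff_smyth_limit\<close>:
  \<open>Y\<^sub>l\<close> converges to \<open>L\<close> if \<open>H Y\<^sub>l L\<close> tends to \<open>0\<close> and, for each single \<open>a \<in> L\<close>, the distance from \<open>a\<close>
  to \<open>Y\<^sub>l\<close> tends to \<open>0\<close>. For a Cauchy net, the limit \<open>L\<close> consists of all balls \<open>a\<close> whose distance to
  \<open>Y\<^sub>l\<close> tends to \<open>0\<close>. It is large enough because a ball of some \<open>Y\<^sub>l\<close> far along the net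
  belongs to \<open>L\<close> after its radius is increased a little; the slack in the radius replaces a limit of
  centres in \<open>X\<close>.
  For the basis, \<open>Y\<close> is the limit of the sets \<open>y\<^sub>0\<close> with \<open>(y, r) \<in> Y\<close> and \<open>r\<close> tending to \<open>0\<close>.
\<close>

section \<open>Hausdorff distances\<close>

lemma ennreal_half_add: "0 < e \<Longrightarrow> ennreal (e / 2) + ennreal (e / 2) = ennreal e"
  by (simp flip: ennreal_plus)

lemma INF_le_approx:
  fixes f :: "'b \<Rightarrow> ennreal"
  assumes "(INF z\<in>Z. f z) \<le> u" "u < top" "0 < e"
  shows "\<exists>z\<in>Z. f z \<le> u + ennreal e"
proof -
  have "(INF z\<in>Z. f z) < u + ennreal e"
    using assms by (cases u) (auto simp: ennreal_less_iff simp flip: ennreal_plus intro: le_less_trans)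
  then show ?thesis
    by (meson INF_less_iff less_imp_le)
qed

lemma hausdorff_sup_leI:
  "z \<in> Z \<Longrightarrow> (\<And>y. y \<in> Y \<Longrightarrow> D y z \<le> u) \<Longrightarrow> hausdorff_sup D Y Z \<le> u"
  unfolding hausdorff_sup_def by (rule INF_lower2) (auto intro: SUP_least)

lemma hausdorff_sup_approx:
  assumes "hausdorff_sup D Y Z \<le> u" "u < top" "0 < e"
  shows "\<exists>z\<in>Z. \<forall>y\<in>Y. D y z \<le> u + ennreal e"
  using INF_le_approx[OF assms(1)[unfolded hausdorff_sup_def] assms(2,3)]
  by (simp add: SUP_le_iff)

lemma hausdorff_sub_approx:
  assumes "hausdorff_sub D Y Z < top" "0 < e" "y \<in> Y"
  shows "\<exists>z\<in>Z. D y z \<le> hausdorff_sub D Y Z + ennreal e"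
  by (rule INF_le_approx) (use assms in \<open>auto simp: hausdorff_sub_def intro: SUP_upper2\<close>)

lemma hausdorff_sub_le_sup: "hausdorff_sub D Y Z \<le> hausdorff_sup D Y Z"
  unfolding hausdorff_sub_def hausdorff_sup_def
  by (auto intro!: SUP_least INF_mono SUP_upper)

lemma distance_onD:
  "distance_on E D \<Longrightarrow> a \<in> E \<Longrightarrow> b \<in> E \<Longrightarrow> c \<in> E \<Longrightarrow> D a c \<le> D a b + D b c"
  by (auto simp: distance_on_def)

text \<open>A single \<open>y \<in> Y\<close> serves all \<open>c \<in> C\<close> in \<open>H C Y\<close>, so a point of \<open>Z\<close> close to that \<open>y\<close> suffices.\<close>

lemma hausdorff_sup_triangle_sub:
  assumes D: "distance_on E D" and sub: "C \<subseteq> E" "Y \<subseteq> E" "Z \<subseteq> E"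
  shows "hausdorff_sup D C Z \<le> hausdorff_sup D C Y + hausdorff_sub D Y Z"
proof (rule ennreal_le_epsilon)
  fix e :: real assume fin: "hausdorff_sup D C Y + hausdorff_sub D Y Z < top" and e: "0 < e"
  obtain y where y: "y \<in> Y" "\<And>c. c \<in> C \<Longrightarrow> D c y \<le> hausdorff_sup D C Y + ennreal (e/2)"
    using hausdorff_sup_approx[of D C Y "hausdorff_sup D C Y" "e/2"] fin e by auto
  obtain z where z: "z \<in> Z" "D y z \<le> hausdorff_sub D Y Z + ennreal (e/2)"
    using hausdorff_sub_approx[of D Y Z "e/2" y] fin e y by auto
  show "hausdorff_sup D C Z \<le> hausdorff_sup D C Y + hausdorff_sub D Y Z + ennreal e"
  proof (rule hausdorff_sup_leI[OF z(1)])
    fix c assume c: "c \<in> C"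
    have "D c z \<le> D c y + D y z"
      using c y(1) z(1) sub by (intro distance_onD[OF D]) auto
    also have "\<dots> \<le> (hausdorff_sup D C Y + ennreal (e/2)) + (hausdorff_sub D Y Z + ennreal (e/2))"
      by (intro add_mono y z c)
    also have "\<dots> = hausdorff_sup D C Y + hausdorff_sub D Y Z + ennreal e"
      by (simp add: ac_simps flip: ennreal_half_add[OF e])
    finally show "D c z \<le> hausdorff_sup D C Y + hausdorff_sub D Y Z + ennreal e" .
  qed
qed

text \<open>A point of \<open>C\<close> that is uniformly close to \<open>Z\<close> can be reached from each \<open>y\<close> through its own
  \<open>z\<close>.\<close>

lemma hausdorff_sub_triangle_sup:
  assumes D: "distance_on E D" and sub: "C \<subseteq> E" "Y \<subseteq> E" "Z \<subseteq> E"
  shows "hausdorff_sup D Y C \<le> hausdorff_sub D Y Z + hausdorff_sup D Z C"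
proof (rule ennreal_le_epsilon)
  fix e :: real assume fin: "hausdorff_sub D Y Z + hausdorff_sup D Z C < top" and e: "0 < e"
  obtain c where c: "c \<in> C" "\<And>z. z \<in> Z \<Longrightarrow> D z c \<le> hausdorff_sup D Z C + ennreal (e/2)"
    using hausdorff_sup_approx[of D Z C "hausdorff_sup D Z C" "e/2"] fin e by auto
  show "hausdorff_sup D Y C \<le> hausdorff_sub D Y Z + hausdorff_sup D Z C + ennreal e"
  proof (rule hausdorff_sup_leI[OF c(1)])
    fix y assume y: "y \<in> Y"
    obtain z where z: "z \<in> Z" "D y z \<le> hausdorff_sub D Y Z + ennreal (e/2)"
      using hausdorff_sub_approx[of D Y Z "e/2" y] fin e y by auto
    have "D y c \<le> D y z + D z c"
      using c(1) y(1) z(1) sub by (intro distance_onD[OF D]) auto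
    also have "\<dots> \<le> (hausdorff_sub D Y Z + ennreal (e/2)) + (hausdorff_sup D Z C + ennreal (e/2))"
      by (intro add_mono c z)
    also have "\<dots> = hausdorff_sub D Y Z + hausdorff_sup D Z C + ennreal e"
      by (simp add: ac_simps flip: ennreal_half_add[OF e])
    finally show "D y c \<le> hausdorff_sub D Y Z + hausdorff_sup D Z C + ennreal e" .
  qed
qed

lemma hausdorff_sup_triangle:
  assumes "distance_on E D" "C \<subseteq> E" "Y \<subseteq> E" "Z \<subseteq> E"
  shows "hausdorff_sup D C Z \<le> hausdorff_sup D C Y + hausdorff_sup D Y Z"
  by (rule order_trans[OF hausdorff_sup_triangle_sub[OF assms]])
    (intro add_left_mono hausdorff_sub_le_sup)

lemma hausdorff_lower_hemimetric_le:
  assumes "distance_on E D" "P \<subseteq> Pow E" "Y \<in> P" "Z \<in> P"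
  shows "lower_hemimetric P (hausdorff_sup D) Y Z \<le> hausdorff_sub D Y Z"
  unfolding lower_hemimetric_def
  by (rule SUP_least) (use assms in \<open>auto simp: pos_diff_le_iff intro!: hausdorff_sup_triangle_sub\<close>)

lemma hausdorff_upper_hemimetric_le:
  assumes "distance_on E D" "P \<subseteq> Pow E" "Y \<in> P" "Z \<in> P"
  shows "upper_hemimetric P (hausdorff_sup D) Y Z \<le> hausdorff_sub D Y Z"
  unfolding upper_hemimetric_def
proof (rule SUP_least)
  fix C assume "C \<in> P"
  then have "hausdorff_sup D Y C \<le> hausdorff_sub D Y Z + hausdorff_sup D Z C"
    using assms by (intro hausdorff_sub_triangle_sup) auto
  then show "pos_diff (hausdorff_sup D Y C) (hausdorff_sup D Z C) \<le> hausdorff_sub D Y Z"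
    by (simp add: pos_diff_le_iff add.commute)
qed

section \<open>Cauchy nets and Smyth limits\<close>

lemma tendsto_0_ennreal_iff:
  fixes f :: "'b \<Rightarrow> ennreal"
  shows "(f \<longlongrightarrow> 0) F \<longleftrightarrow> (\<forall>e>0. \<forall>\<^sub>F l in F. f l \<le> ennreal e)"
proof
  assume f: "(f \<longlongrightarrow> 0) F"
  show "\<forall>e>0. \<forall>\<^sub>F l in F. f l \<le> ennreal e"
  proof (intro allI impI)
    fix e :: real assume "0 < e"
    then have "\<forall>\<^sub>F l in F. f l < ennreal e"
      using order_tendstoD(2)[OF f] by simp
    then show "\<forall>\<^sub>F l in F. f l \<le> ennreal e"
      by eventually_elim simp
  qed
next
  assume f: "\<forall>e>0. \<forall>\<^sub>F l in F. f l \<le> ennreal e"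
  show "(f \<longlongrightarrow> 0) F"
  proof (rule order_tendstoI)
    fix a :: ennreal assume "0 < a"
    then obtain b where b: "0 < b" "b < a" using dense by blast
    then obtain e where "b = ennreal e" "0 < e"
      by (cases b) auto
    then show "\<forall>\<^sub>F l in F. f l < a"
      using f b by (auto elim!: eventually_mono intro: le_less_trans)
  qed simp
qed

lemma cauchy_net_iff:
  "cauchy_net d \<Lambda> prec x \<longleftrightarrow> net_index \<Lambda> prec \<and>
     (\<forall>e>0. \<exists>\<gamma>0\<in>\<Lambda>. \<forall>\<gamma>\<in>\<Lambda>. \<forall>\<delta>\<in>\<Lambda>. prec \<gamma>0 \<gamma> \<longrightarrow> prec \<gamma> \<delta> \<longrightarrow> d (x \<gamma>) (x \<delta>) \<le> ennreal e)"
  unfolding cauchy_net_def tendsto_0_ennreal_iff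
  by (rule conj_cong[OF refl]) (simp add: eventually_tails SUP_le_iff, blast)

lemma net_index_above:
  "net_index \<Lambda> prec \<Longrightarrow> \<gamma> \<in> \<Lambda> \<Longrightarrow> \<exists>\<delta>\<in>\<Lambda>. prec \<gamma> \<delta>"
  unfolding net_index_def by blast

lemma eventually_in_index:
  assumes "net_index \<Lambda> prec"
  shows "\<forall>\<^sub>F i in tails \<Lambda> prec. i \<in> \<Lambda>"
proof -
  have "\<Lambda> \<noteq> {}" using assms by (simp add: net_index_def)
  then show ?thesis by (auto simp: eventually_tails[OF assms])
qed

lemma eventually_tails_ex:
  assumes "net_index \<Lambda> prec" "eventually P (tails \<Lambda> prec)"
  shows "\<exists>l\<in>\<Lambda>. P l"
proof -
  obtain \<gamma> where "\<gamma> \<in> \<Lambda>" "\<forall>\<delta>\<in>\<Lambda>. prec \<gamma> \<delta> \<longrightarrow> P \<delta>"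
    using assms(2) unfolding eventually_tails[OF assms(1)] by blast
  with net_index_above[OF assms(1)] show ?thesis by blast
qed

text \<open>A criterion that treats finite and infinite values of \<open>d c l\<close> alike: if \<open>d c l = \<infinity>\<close> then
  the first condition is void and the second forces \<open>d c (x \<lambda>) = \<infinity>\<close> eventually.\<close>

lemma smyth_limitI:
  assumes l: "l \<in> X" and x: "\<forall>\<^sub>F i in F. x i \<in> X"
    and up: "\<And>c e. c \<in> X \<Longrightarrow> 0 < e \<Longrightarrow> \<forall>\<^sub>F i in F. d c (x i) \<le> d c l + ennreal e"
    and lo: "\<And>c e. c \<in> X \<Longrightarrow> 0 < e \<Longrightarrow> \<forall>\<^sub>F i in F. d c l \<le> d c (x i) + ennreal e"
  shows "limitin (smyth_topology X d) x l F"
  unfolding limitin_def topspace_smyth_topology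
proof (intro conjI l allI impI)
  fix U assume "openin (smyth_topology X d) U \<and> l \<in> U"
  then have U: "generate_topology_on
     ({{x\<in>X. enn2ereal (d c x) < ereal r} | c r. c \<in> X} \<union>
      {{x\<in>X. enn2ereal (d c x) > ereal r} | c r. c \<in> X}) U" and "l \<in> U"
    by (auto simp: smyth_topology_def openin_topology_generated_by_iff)
  then show "\<forall>\<^sub>F i in F. x i \<in> U"
  proof (induction rule: generate_topology_on.induct)
    case Empty
    then show ?case by simp
  next
    case (Int a b)
    then show ?case by (auto intro: eventually_conj)
  next
    case (UN K)
    then obtain k where k: "k \<in> K" "l \<in> k" by blast
    from UN.IH[OF this] show ?case
      by eventually_elim (use k in blast)
  next
    case (Basis s)
    then consider (less) c r where "c \<in> X" "s = {x\<in>X. enn2ereal (d c x) < ereal r}"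
      | (greater) c r where "c \<in> X" "s = {x\<in>X. enn2ereal (d c x) > ereal r}"
      by blast
    then show ?case
    proof cases
      case less
      with Basis have less_r: "enn2ereal (d c l) < ereal r" by simp
      then obtain t where t: "d c l = ennreal t" "0 \<le> t" "t < r"
        by (cases "d c l") auto
      have "\<forall>\<^sub>F i in F. d c (x i) \<le> d c l + ennreal ((r - t) / 2)"
        using t by (intro up less) auto
      with x show ?thesis
      proof eventually_elim
        case (elim i)
        have "d c (x i) \<le> ennreal ((r + t) / 2)"
          using elim t by (simp flip: ennreal_plus add: field_simps)
        also have "\<dots> < ennreal r" using t by (simp add: ennreal_less_iff)
        finally show ?case
          using elim t unfolding less by (simp add: less_ennreal.rep_eq)
      qed
    next
      case greater
      with Basis have gr: "ereal r < enn2ereal (d c l)" by simp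
      show ?thesis
      proof (cases "r < 0")
        case True
        have "ereal r < enn2ereal b" for b
          by (rule less_le_trans[of _ 0]) (use True in auto)
        then show ?thesis
          using x unfolding greater by (auto elim: eventually_mono)
      next
        case False
        then have "ennreal r < d c l" using gr by (simp add: less_ennreal.rep_eq)
        then obtain b where b: "ennreal r < b" "b < d c l" using dense by blast
        then obtain t where t: "b = ennreal t" "r < t"
          using False by (cases b) (auto simp: ennreal_less_iff)
        have "\<forall>\<^sub>F i in F. d c l \<le> d c (x i) + ennreal (t - r)"
          using t by (intro lo greater) auto
        with x show ?thesis
        proof eventually_elim
          case (elim i)
          have "ennreal r < d c (x i)"
          proof (rule ccontr)
            assume "\<not> ennreal r < d c (x i)"
            then have "d c (x i) + ennreal (t - r) \<le> ennreal r + ennreal (t - r)"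
              by (intro add_mono) auto
            also have "\<dots> = ennreal t" using False t by (simp flip: ennreal_plus)
            finally show False using elim b t by auto
          qed
          then show ?case
            using elim False unfolding greater by (simp add: less_ennreal.rep_eq)
        qed
      qed
    qed
  qed
qed

lemma smyth_limit_eventually_less:
  assumes "limitin (smyth_topology X d) x l F" "c \<in> X" "d c l < ennreal r"
  shows "\<forall>\<^sub>F i in F. d c (x i) < ennreal r"
proof -
  have r: "0 \<le> r" using assms(3) by (cases "0 \<le> r") (auto simp: ennreal_neg)
  have "openin (smyth_topology X d) {x\<in>X. enn2ereal (d c x) < ereal r}"
    unfolding smyth_topology_def using assms(2) by (intro topology_generated_by_Basis) blast
  moreover have "l \<in> {x\<in>X. enn2ereal (d c x) < ereal r}"
    using assms r by (auto simp: limitin_def topspace_smyth_topology less_ennreal.rep_eq)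
  ultimately have "\<forall>\<^sub>F i in F. x i \<in> {x\<in>X. enn2ereal (d c x) < ereal r}"
    using assms(1) by (auto simp: limitin_def)
  then show ?thesis
    by eventually_elim (use r in \<open>simp add: less_ennreal.rep_eq\<close>)
qed

lemma smyth_limit_eventually_greater:
  assumes "limitin (smyth_topology X d) x l F" "c \<in> X" "ennreal r < d c l" "0 \<le> r"
  shows "\<forall>\<^sub>F i in F. ennreal r < d c (x i)"
proof -
  have "openin (smyth_topology X d) {x\<in>X. enn2ereal (d c x) > ereal r}"
    unfolding smyth_topology_def using assms(2) by (intro topology_generated_by_Basis) blast
  moreover have "l \<in> {x\<in>X. enn2ereal (d c x) > ereal r}"
    using assms by (auto simp: limitin_def topspace_smyth_topology less_ennreal.rep_eq)
  ultimately have "\<forall>\<^sub>F i in F. x i \<in> {x\<in>X. enn2ereal (d c x) > ereal r}"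
    using assms(1) by (auto simp: limitin_def)
  then show ?thesis
    by eventually_elim (use assms(4) in \<open>simp add: less_ennreal.rep_eq\<close>)
qed

text \<open>Far along a Cauchy net \<open>x\<close> converging to \<open>l\<close>, the point \<open>x \<gamma>\<close> is close to all later
  \<open>x \<delta>\<close>, hence to \<open>l\<close>, since \<open>d (x \<gamma>)\<close> is continuous. The same continuity for \<open>d c\<close> gives the bounds
  for finitely many \<open>c\<close> simultaneously.\<close>

lemma smyth_continuous_approx:
  fixes I :: "'i itself"
  assumes cont: "smyth_continuous I X d" and l: "l \<in> X"
    and C: "finite C" "C \<subseteq> X" and e: "0 < e"
  shows "\<exists>z\<in>X. d z l \<le> ennreal e \<and> (\<forall>c\<in>C. d c z \<le> d c l + ennreal e)"
proof -
  obtain \<Lambda> :: "'i set" and prec x where x: "x ` \<Lambda> \<subseteq> X" "cauchy_net d \<Lambda> prec x"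
      and lim: "limitin (smyth_topology X d) x l (tails \<Lambda> prec)"
    using cont l unfolding smyth_continuous_def smyth_basis_def by blast
  have net: "net_index \<Lambda> prec" using x(2) by (simp add: cauchy_net_def)
  have "\<forall>\<^sub>F i in tails \<Lambda> prec. d c (x i) \<le> d c l + ennreal e" if c: "c \<in> C" for c
  proof (cases "d c l")
    case (real t)
    then have "d c l < ennreal (t + e)" using e by (simp add: ennreal_less_iff)
    then have "\<forall>\<^sub>F i in tails \<Lambda> prec. d c (x i) < ennreal (t + e)"
      using c C by (intro smyth_limit_eventually_less[OF lim]) auto
    then show ?thesis
      by eventually_elim (use real e in auto)
  qed auto
  then have near: "\<forall>\<^sub>F i in tails \<Lambda> prec. \<forall>c\<in>C. d c (x i) \<le> d c l + ennreal e"
    using C(1) by (simp add: eventually_ball_finite)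
  have "\<forall>\<^sub>F i in tails \<Lambda> prec. \<forall>j\<in>\<Lambda>. prec i j \<longrightarrow> d (x i) (x j) \<le> ennreal e"
    using x(2) e unfolding cauchy_net_iff eventually_tails[OF net] by blast
  moreover note eventually_in_index[OF net]
  ultimately have "\<forall>\<^sub>F i in tails \<Lambda> prec. d (x i) l \<le> ennreal e"
  proof eventually_elim
    case (elim i)
    show ?case
    proof (rule ccontr)
      assume "\<not> d (x i) l \<le> ennreal e"
      then have "\<forall>\<^sub>F j in tails \<Lambda> prec. ennreal e < d (x i) (x j)"
        using x(1) elim(2) e by (intro smyth_limit_eventually_greater[OF lim]) auto
      moreover have "\<forall>\<^sub>F j in tails \<Lambda> prec. d (x i) (x j) \<le> ennreal e"
        using elim net by (auto simp: eventually_tails)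
      ultimately have "\<forall>\<^sub>F j in tails \<Lambda> prec. False"
        by eventually_elim auto
      then show False using eventually_tails_ex[OF net] by blast
    qed
  qed
  with near have "\<forall>\<^sub>F i in tails \<Lambda> prec. d (x i) l \<le> ennreal e \<and> (\<forall>c\<in>C. d c (x i) \<le> d c l + ennreal e)"
    by eventually_elim auto
  then show ?thesis
    using eventually_tails_ex[OF net] x(1) by blast
qed

text \<open>The two conditions are asymmetric, uniform over \<open>Y l\<close> but pointwise over \<open>L\<close>. Pointwise
  suffices in the second one because a single \<open>a \<in> L\<close> already almost realises
  \<open>hausdorff_sup D C L\<close>.\<close>

lemma hausdorff_smyth_limit:
  assumes D: "distance_on E D" and P: "P \<subseteq> Pow E" and L: "L \<in> P"
    and Y: "\<forall>\<^sub>F l in F. Y l \<in> P"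
    and to_L: "\<And>e. 0 < e \<Longrightarrow> \<forall>\<^sub>F l in F. hausdorff_sup D (Y l) L \<le> ennreal e"
    and from_L: "\<And>a e. a \<in> L \<Longrightarrow> 0 < e \<Longrightarrow> \<forall>\<^sub>F l in F. (INF b\<in>Y l. D a b) \<le> ennreal e"
  shows "limitin (smyth_topology P (hausdorff_sup D)) Y L F"
proof (rule smyth_limitI[OF L Y])
  fix C and e :: real assume C: "C \<in> P" and e: "0 < e"
  show "\<forall>\<^sub>F l in F. hausdorff_sup D C L \<le> hausdorff_sup D C (Y l) + ennreal e"
    using to_L[OF e] Y
  proof eventually_elim
    case (elim l)
    have "hausdorff_sup D C L \<le> hausdorff_sup D C (Y l) + hausdorff_sup D (Y l) L"
      using C L P elim by (intro hausdorff_sup_triangle[OF D]) auto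
    also have "\<dots> \<le> hausdorff_sup D C (Y l) + ennreal e"
      by (intro add_left_mono elim)
    finally show ?case .
  qed
  show "\<forall>\<^sub>F l in F. hausdorff_sup D C (Y l) \<le> hausdorff_sup D C L + ennreal e"
  proof (cases "hausdorff_sup D C L < top")
    case True
    then obtain a where a: "a \<in> L" "\<And>c. c \<in> C \<Longrightarrow> D c a \<le> hausdorff_sup D C L + ennreal (e/2)"
      using hausdorff_sup_approx[of D C L "hausdorff_sup D C L" "e/2"] e by auto
    have "\<forall>\<^sub>F l in F. (INF b\<in>Y l. D a b) \<le> ennreal (e/2)"
      using a e by (intro from_L) auto
    then show ?thesis using Y
    proof eventually_elim
      case (elim l)
      have "hausdorff_sup D C (Y l) \<le> hausdorff_sup D C {a} + hausdorff_sub D {a} (Y l)"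
        using C L P elim a by (intro hausdorff_sup_triangle_sub[OF D]) auto
      also have "\<dots> \<le> (hausdorff_sup D C L + ennreal (e/2)) + ennreal (e/2)"
        using a elim by (intro add_mono hausdorff_sup_leI) (auto simp: hausdorff_sub_def)
      finally show ?case by (simp add: ac_simps ennreal_half_add[OF e])
    qed
  next
    case False
    then show ?thesis by (simp add: less_top[symmetric])
  qed
qed

lemma smyth_basis_superset:
  fixes I :: "'i itself"
  assumes A: "smyth_basis I A X d" and "A \<subseteq> B" "B \<subseteq> X"
  shows "smyth_basis I B X d"
  unfolding smyth_basis_def
proof (intro conjI ballI \<open>B \<subseteq> X\<close>)
  fix l assume "l \<in> X"
  then obtain \<Lambda> :: "'i set" and prec x where "x ` \<Lambda> \<subseteq> A" "cauchy_net d \<Lambda> prec x"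
      "limitin (smyth_topology X d) x l (tails \<Lambda> prec)"
    using A unfolding smyth_basis_def by blast
  then show "\<exists>(\<Lambda> :: 'i set) prec x. x ` \<Lambda> \<subseteq> B \<and> cauchy_net d \<Lambda> prec x \<and>
      limitin (smyth_topology X d) x l (tails \<Lambda> prec)"
    using \<open>A \<subseteq> B\<close> by (intro exI[of _ \<Lambda>] exI[of _ prec] exI[of _ x] conjI) auto
qed

section \<open>Formal balls and directed sets of aperture zero\<close>

lemma ball_dist_le_iff:
  "ball_dist d (x, r) (y, s) \<le> c \<longleftrightarrow> d x y + ennreal s \<le> ennreal r + c"
  by (auto simp: ball_dist_def ennreal_minus_le_iff)

lemma distance_on_ball_dist:
  assumes "distance_on X d"
  shows "distance_on (formal_balls X) (ball_dist d)"
  unfolding distance_on_def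
proof (intro ballI)
  fix a b c assume "a \<in> formal_balls X" "b \<in> formal_balls X" "c \<in> formal_balls X"
  then obtain x r y s z t where a: "a = (x, r)" and b: "b = (y, s)" and c: "c = (z, t)"
      and X: "x \<in> X" "y \<in> X" "z \<in> X"
    by (auto simp: formal_balls_def)
  have "d x z + ennreal t \<le> d x y + (d y z + ennreal t)"
    using distance_onD[OF assms X] by (simp add: add_right_mono flip: add.assoc)
  also have "\<dots> \<le> d x y + (ennreal s + ball_dist d b c)"
    unfolding b c by (intro add_left_mono) (simp flip: ball_dist_le_iff)
  also have "\<dots> = (d x y + ennreal s) + ball_dist d b c" by (simp add: ac_simps)
  also have "\<dots> \<le> (ennreal r + ball_dist d a b) + ball_dist d b c"
    unfolding a b by (intro add_right_mono) (simp flip: ball_dist_le_iff)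
  finally show "ball_dist d a c \<le> ball_dist d a b + ball_dist d b c"
    unfolding a c ball_dist_le_iff by (simp add: ac_simps)
qed

lemma directed_balls_0I:
  assumes "Y \<subseteq> formal_balls X"
    and ex: "\<And>F e. finite F \<Longrightarrow> F \<subseteq> Y \<Longrightarrow> 0 < e \<Longrightarrow>
      \<exists>(y, r)\<in>Y. r < e \<and> (\<forall>a\<in>F. ball_dist d a (y, r) \<le> ennreal e)"
  shows "Y \<in> directed_balls_0 X d"
proof -
  have "(INF y\<in>Y. SUP z\<in>F. ball_dist d z y) \<le> 0" if "finite F" "F \<subseteq> Y" for F
  proof (rule ennreal_le_epsilon)
    fix e :: real assume "0 < e"
    from ex[OF that this] show "(INF y\<in>Y. SUP z\<in>F. ball_dist d z y) \<le> 0 + ennreal e"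
      by (auto intro!: INF_lower2 SUP_least)
  qed
  moreover have "aperture Y \<le> 0"
  proof (rule ennreal_le_epsilon)
    fix e :: real assume "0 < e"
    from ex[OF _ _ this, of "{}"] obtain y r where "(y, r) \<in> Y" "r < e" by auto
    then show "aperture Y \<le> 0 + ennreal e"
      unfolding aperture_def by (intro INF_lower2[of "(y, r)"]) (auto intro: ennreal_leI)
  qed
  ultimately show ?thesis
    using assms(1) by (auto simp: directed_balls_0_def directed_for_def)
qed

text \<open>Directedness and vanishing aperture can be used together, as radii hardly increase along
  \<open>D\<close>: \<open>s \<le> r + D (x, r) (y, s)\<close>. It suffices to add a ball of small radius to \<open>F\<close>.\<close>

lemma directed_balls_0D:
  assumes Y: "Y \<in> directed_balls_0 X d" and F: "finite F" "F \<subseteq> Y" and e: "0 < e"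
  obtains y r where "(y, r) \<in> Y" "r < e" "\<And>a. a \<in> F \<Longrightarrow> ball_dist d a (y, r) \<le> ennreal e"
proof -
  have "\<exists>a\<in>Y. (case a of (x, r) \<Rightarrow> ennreal r) \<le> 0 + ennreal (e/3)"
    by (rule INF_le_approx) (use Y e in \<open>auto simp: directed_balls_0_def aperture_def\<close>)
  then obtain x s where x: "(x, s) \<in> Y" "ennreal s \<le> ennreal (e/3)" by auto
  then have s: "0 \<le> s" "s \<le> e/3"
    using Y e by (auto simp: directed_balls_0_def formal_balls_def)
  have "\<exists>y\<in>Y. (SUP z\<in>insert (x, s) F. ball_dist d z y) \<le> 0 + ennreal (e/3)"
  proof (rule INF_le_approx)
    have "finite (insert (x, s) F) \<and> insert (x, s) F \<subseteq> Y" using F x by simp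
    then show "(INF y\<in>Y. SUP z\<in>insert (x, s) F. ball_dist d z y) \<le> 0"
      using Y unfolding directed_balls_0_def directed_for_def by auto
  qed (use e in auto)
  then obtain b where b: "b \<in> Y" "\<forall>a\<in>insert (x, s) F. ball_dist d a b \<le> ennreal (e/3)"
    by (auto simp: SUP_le_iff)
  obtain y r where yr: "b = (y, r)" by (cases b)
  have "d x y + ennreal r \<le> ennreal s + ennreal (e/3)"
    using b unfolding yr by (simp flip: ball_dist_le_iff)
  then have "ennreal r \<le> ennreal s + ennreal (e/3)"
    by (rule order_trans[rotated]) simp
  then have "r \<le> s + e/3"
    using s e by (simp flip: ennreal_plus)
  then have "r < e" using s e by simp
  moreover have "ball_dist d a (y, r) \<le> ennreal e" if "a \<in> F" for a
    using b that e unfolding yr by (auto intro!: order_trans[OF _ ennreal_leI[of "e/3" e]])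
  ultimately show ?thesis using that b yr by blast
qed

section \<open>The sets \<open>x\<^sub>0\<close> and the lower hemimetric\<close>

locale approximable_distance =
  fixes X :: "'a set" and d :: "'a \<Rightarrow> 'a \<Rightarrow> ennreal"
  assumes distance: "distance_on X d"
    and approx: "\<And>x C e. x \<in> X \<Longrightarrow> finite C \<Longrightarrow> C \<subseteq> X \<Longrightarrow> 0 < e \<Longrightarrow>
      \<exists>z\<in>X. d z x \<le> ennreal e \<and> (\<forall>c\<in>C. d c z \<le> d c x + ennreal e)"
begin

abbreviation "E \<equiv> formal_balls X"
abbreviation "D \<equiv> ball_dist d"
abbreviation "P \<equiv> directed_balls_0 X d"
abbreviation "H \<equiv> hausdorff_sup D"

lemma triangle: "x \<in> X \<Longrightarrow> y \<in> X \<Longrightarrow> z \<in> X \<Longrightarrow> d x z \<le> d x y + d y z"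
  by (rule distance_onD[OF distance])

lemma distance_D: "distance_on E D"
  by (rule distance_on_ball_dist[OF distance])

lemma P_subset: "P \<subseteq> Pow E"
  by (auto simp: directed_balls_0_def)

lemma in_E: "Y \<in> P \<Longrightarrow> (x, r) \<in> Y \<Longrightarrow> x \<in> X \<and> 0 \<le> r"
  by (auto simp: directed_balls_0_def formal_balls_def)

lemma in_ball_ideal_iff: "(z, s) \<in> ball_ideal X d x \<longleftrightarrow> z \<in> X \<and> 0 \<le> s \<and> d z x \<le> ennreal s"
  by (auto simp: ball_ideal_def formal_balls_def)

lemma approx_in_ball_ideal:
  assumes "x \<in> X" "finite C" "C \<subseteq> X" "0 < e"
  obtains z where "z \<in> X" "(z, e) \<in> ball_ideal X d x" "\<And>c. c \<in> C \<Longrightarrow> d c z \<le> d c x + ennreal e"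
  using approx[OF assms] assms(4) by (auto simp: in_ball_ideal_iff)

lemma ball_ideal_in_P:
  assumes x: "x \<in> X"
  shows "ball_ideal X d x \<in> P"
proof (rule directed_balls_0I)
  show "ball_ideal X d x \<subseteq> E" by (auto simp: ball_ideal_def)
next
  fix F and e :: real assume F: "finite F" "F \<subseteq> ball_ideal X d x" and e: "0 < e"
  obtain z where z: "(z, e/2) \<in> ball_ideal X d x"
      "\<And>c. c \<in> fst ` F \<Longrightarrow> d c z \<le> d c x + ennreal (e/2)"
    by (rule approx_in_ball_ideal[OF x, of "fst ` F" "e/2"])
      (use F e in \<open>auto simp: ball_ideal_def formal_balls_def\<close>)
  have "D (c, s) (z, e/2) \<le> ennreal e" if c: "(c, s) \<in> F" for c s
  proof -
    have "d c x \<le> ennreal s" using c F by (auto simp: in_ball_ideal_iff)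
    moreover have "d c z \<le> d c x + ennreal (e/2)" using z(2) c by force
    ultimately have "d c z + ennreal (e/2) \<le> (ennreal s + ennreal (e/2)) + ennreal (e/2)"
      by (intro add_right_mono) (auto intro: order_trans add_right_mono)
    then show ?thesis
      unfolding ball_dist_le_iff by (simp add: add.assoc ennreal_half_add[OF e])
  qed
  then show "\<exists>(y, r)\<in>ball_ideal X d x. r < e \<and> (\<forall>a\<in>F. D a (y, r) \<le> ennreal e)"
    using z(1) e by (intro bexI[of _ "(z, e/2)"]) auto
qed

lemma H_ball_ideal_le:
  assumes x: "x \<in> X" and y: "y \<in> X"
  shows "H (ball_ideal X d x) (ball_ideal X d y) \<le> d x y"
proof (rule ennreal_le_epsilon)
  fix e :: real assume e: "0 < e"
  obtain z where z: "z \<in> X" "(z, e/2) \<in> ball_ideal X d y" "d x z \<le> d x y + ennreal (e/2)"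
    by (rule approx_in_ball_ideal[OF y, of "{x}" "e/2"]) (use x e in auto)
  show "H (ball_ideal X d x) (ball_ideal X d y) \<le> d x y + ennreal e"
  proof (rule hausdorff_sup_leI[OF z(2)])
    fix a assume "a \<in> ball_ideal X d x"
    then obtain c s where a: "a = (c, s)" and c: "c \<in> X" "d c x \<le> ennreal s"
      by (cases a) (auto simp: in_ball_ideal_iff)
    have "d c z \<le> ennreal s + (d x y + ennreal (e/2))"
      using triangle[OF c(1) x z(1)] add_mono[OF c(2) z(3)] by (rule order_trans)
    then have "d c z + ennreal (e/2) \<le> (ennreal s + (d x y + ennreal (e/2))) + ennreal (e/2)"
      by (rule add_right_mono)
    then show "D a (z, e/2) \<le> d x y + ennreal e"
      unfolding a ball_dist_le_iff by (simp add: add.assoc ennreal_half_add[OF e])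
  qed
qed

text \<open>For \<open>(c, s) \<in> x\<^sub>0\<close> and \<open>(w, t) \<in> Y\<close> the triangle inequality gives
  \<open>d c w - s + t \<le> d x w + t\<close>, which exceeds \<open>r\<close> by at most \<open>D (x, r) (w, t)\<close>. As \<open>Y\<close> is directed,
  the latter is small for a suitable \<open>(w, t)\<close>.\<close>

lemma H_ball_ideal_to:
  assumes Y: "Y \<in> P" and xr: "(x, r) \<in> Y"
  shows "H (ball_ideal X d x) Y \<le> ennreal r"
proof (rule ennreal_le_epsilon)
  fix e :: real assume e: "0 < e"
  obtain w t where w: "(w, t) \<in> Y" "D (x, r) (w, t) \<le> ennreal e"
    by (rule directed_balls_0D[OF Y, of "{(x, r)}" e]) (use xr e in auto)
  have X: "x \<in> X" "w \<in> X" using in_E[OF Y] xr w by auto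
  show "H (ball_ideal X d x) Y \<le> ennreal r + ennreal e"
  proof (rule hausdorff_sup_leI[OF w(1)])
    fix a assume "a \<in> ball_ideal X d x"
    then obtain c s where a: "a = (c, s)" and c: "c \<in> X" "d c x \<le> ennreal s"
      by (cases a) (auto simp: in_ball_ideal_iff)
    have "d c w + ennreal t \<le> d c x + (d x w + ennreal t)"
      using triangle[OF c(1) X] by (simp add: add_right_mono flip: add.assoc)
    also have "\<dots> \<le> ennreal s + (ennreal r + ennreal e)"
      by (rule add_mono[OF c(2) w(2)[unfolded ball_dist_le_iff]])
    finally show "D a (w, t) \<le> ennreal r + ennreal e"
      unfolding a ball_dist_le_iff .
  qed
qed

lemma dist_to_ball_ideal_le:
  assumes a: "a \<in> E" and y: "y \<in> X"
  shows "(INF b\<in>ball_ideal X d y. D a b) \<le> D a (y, r)"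
proof (rule ennreal_le_epsilon)
  fix e :: real assume e: "0 < e"
  obtain x s where xs: "a = (x, s)" "x \<in> X" using a by (auto simp: formal_balls_def)
  obtain z where z: "z \<in> X" "(z, e/2) \<in> ball_ideal X d y" "d x z \<le> d x y + ennreal (e/2)"
    by (rule approx_in_ball_ideal[OF y, of "{x}" "e/2"]) (use xs e in auto)
  have "d x y + ennreal r \<le> ennreal s + D a (y, r)"
    unfolding xs by (simp flip: ball_dist_le_iff)
  then have le: "d x y \<le> ennreal s + D a (y, r)"
    by (rule order_trans[rotated]) simp
  have "d x z + ennreal (e/2) \<le> (d x y + ennreal (e/2)) + ennreal (e/2)"
    by (intro add_right_mono z)
  also have "\<dots> = d x y + ennreal e" by (simp add: add.assoc ennreal_half_add[OF e])
  also have "\<dots> \<le> (ennreal s + D a (y, r)) + ennreal e"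
    by (intro add_right_mono le)
  finally have "D a (z, e/2) \<le> D a (y, r) + ennreal e"
    unfolding xs ball_dist_le_iff by (simp add: add.assoc)
  then show "(INF b\<in>ball_ideal X d y. D a b) \<le> D a (y, r) + ennreal e"
    by (rule INF_lower2[OF z(2)])
qed

text \<open>Moving to \<open>(x', r') \<in> Y\<close> close to \<open>(x, r)\<close> leaves room for a point \<open>z\<close> with
  \<open>(z, q) \<in> x'\<^sub>0\<close>, for \<open>q\<close> small, and \<open>d x z\<close> at most about \<open>d x x'\<close>. A bound for \<open>H x'\<^sub>0 Z\<close> then
  bounds the distance from \<open>(x, r)\<close> to \<open>Z\<close> by way of \<open>z\<close>.\<close>

lemma hausdorff_sub_le_lower_hemimetric:
  assumes Y: "Y \<in> P" and Z: "Z \<in> P"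
  shows "hausdorff_sub D Y Z \<le> lower_hemimetric P H Y Z"
  unfolding hausdorff_sub_def
proof (rule SUP_least, rule ennreal_le_epsilon)
  let ?L = "lower_hemimetric P H Y Z"
  fix a and e :: real assume a: "a \<in> Y" and L: "?L < top" and e: "0 < e"
  define q where "q = e / 4"
  have q: "0 < q" "ennreal q + (ennreal q + (ennreal q + ennreal q)) = ennreal e"
    using e by (auto simp: q_def simp flip: ennreal_plus)
  obtain x r where xr: "a = (x, r)" by (cases a)
  obtain x' r' where x': "(x', r') \<in> Y" "D a (x', r') \<le> ennreal q"
    by (rule directed_balls_0D[OF Y, of "{a}" q]) (use a q in auto)
  have X: "x \<in> X" "x' \<in> X" using in_E[OF Y] a xr x' by auto
  let ?C = "ball_ideal X d x'"
  have "pos_diff (H ?C Z) (H ?C Y) \<le> ?L"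
    unfolding lower_hemimetric_def by (rule SUP_upper[OF ball_ideal_in_P[OF X(2)]])
  then have "H ?C Z \<le> H ?C Y + ?L" by (simp add: pos_diff_le_iff)
  also have "\<dots> \<le> ennreal r' + ?L"
    by (intro add_right_mono H_ball_ideal_to Y x')
  finally have HZ: "H ?C Z \<le> ennreal r' + ?L" .
  obtain w t where w: "(w, t) \<in> Z" "\<And>c. c \<in> ?C \<Longrightarrow> D c (w, t) \<le> ennreal r' + ?L + ennreal q"
    using hausdorff_sup_approx[OF HZ _ q(1)] L by auto
  have wX: "w \<in> X" using in_E[OF Z] w by auto
  obtain z where z: "z \<in> X" "(z, q) \<in> ?C" "d x z \<le> d x x' + ennreal q"
    by (rule approx_in_ball_ideal[OF X(2), of "{x}" q]) (use X q in auto)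
  have "d x w + ennreal t \<le> d x z + (d z w + ennreal t)"
    using triangle[OF X(1) z(1) wX] by (simp add: add_right_mono flip: add.assoc)
  also have "\<dots> \<le> (d x x' + ennreal q) + (ennreal q + (ennreal r' + ?L + ennreal q))"
    by (rule add_mono[OF z(3) w(2)[OF z(2), unfolded ball_dist_le_iff]])
  also have "\<dots> = (d x x' + ennreal r') + (?L + (ennreal q + (ennreal q + ennreal q)))"
    by (simp add: ac_simps)
  also have "\<dots> \<le> (ennreal r + ennreal q) + (?L + (ennreal q + (ennreal q + ennreal q)))"
    using x'(2) unfolding xr by (intro add_right_mono) (simp flip: ball_dist_le_iff)
  also have "\<dots> = ennreal r + (?L + ennreal e)"
    by (simp add: ac_simps flip: q(2))
  finally have "D a (w, t) \<le> ?L + ennreal e"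
    unfolding xr ball_dist_le_iff .
  then show "(INF z\<in>Z. D a z) \<le> ?L + ennreal e"
    by (rule INF_lower2[OF w(1)])
qed

lemma lower_hemimetric_H_eq:
  "Y \<in> P \<Longrightarrow> Z \<in> P \<Longrightarrow> lower_hemimetric P H Y Z = hausdorff_sub D Y Z"
  by (intro antisym hausdorff_sub_le_lower_hemimetric
      hausdorff_lower_hemimetric_le[OF distance_D P_subset])

section \<open>Basis and completeness\<close>

text \<open>The net is indexed by balls of \<open>Y\<close> paired with a tolerance \<open>\<epsilon>\<close>. Asking for
  \<open>D a b + \<epsilon>' \<le> \<epsilon>\<close> when \<open>(b, \<epsilon>')\<close> follows \<open>(a, \<epsilon>)\<close> makes the order transitive, and \<open>r < \<epsilon>\<close> makes
  the radii tend to \<open>0\<close>.\<close>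

lemma ball_ideal_basis: "smyth_basis TYPE(('a \<times> real) \<times> real) (ball_ideal X d ` X) P H"
  unfolding smyth_basis_def
proof (intro conjI ballI)
  show "ball_ideal X d ` X \<subseteq> P" using ball_ideal_in_P by blast
next
  fix Y assume Y: "Y \<in> P"
  define \<Lambda> :: "(('a \<times> real) \<times> real) set" where "\<Lambda> = {(a, q). a \<in> Y \<and> snd a < q}"
  define prec where "prec = (\<lambda>(a, q) (b, q'). D a b + ennreal q' \<le> ennreal q)"
  define f :: "('a \<times> real) \<times> real \<Rightarrow> ('a \<times> real) set" where "f = (\<lambda>((y, r), q). ball_ideal X d y)"
  have YE: "Y \<subseteq> E" using Y P_subset by auto
  have pos: "0 \<le> snd a \<and> 0 < q" if "(a, q) \<in> \<Lambda>" for a q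
    using that in_E[OF Y, of "fst a" "snd a"] by (auto simp: \<Lambda>_def)
  have precD: "D a b \<le> ennreal q" "q' \<le> q" if "prec (a, q) (b, q')" "(a, q) \<in> \<Lambda>" for a b q q'
  proof -
    have "D a b + ennreal q' \<le> ennreal q" using that by (simp add: prec_def)
    moreover from this have "ennreal q' \<le> ennreal q" by (rule order_trans[rotated]) simp
    ultimately show "D a b \<le> ennreal q" and "q' \<le> q"
      using pos[OF that(2)] by (auto intro: order_trans[rotated])
  qed
  have net: "net_index \<Lambda> prec"
    unfolding net_index_def
  proof (intro conjI ballI impI)
    obtain y r where "(y, r) \<in> Y" "r < 1"
      by (rule directed_balls_0D[OF Y, of "{}" 1]) auto
    then have "((y, r), 1) \<in> \<Lambda>" by (simp add: \<Lambda>_def)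
    then show "\<Lambda> \<noteq> {}" by blast
  next
    fix i j k assume \<Lambda>: "i \<in> \<Lambda>" "j \<in> \<Lambda>" "k \<in> \<Lambda>" and ij: "prec i j" and jk: "prec j k"
    obtain a b c p q r where i: "i = (a, p)" and j: "j = (b, q)" and k: "k = (c, r)"
      by (cases i, cases j, cases k)
    have "D a c \<le> D a b + D b c"
      using \<Lambda> YE unfolding i j k by (intro distance_onD[OF distance_D]) (auto simp: \<Lambda>_def)
    then have "D a c + ennreal r \<le> D a b + (D b c + ennreal r)"
      by (simp add: add_right_mono flip: add.assoc)
    also have "\<dots> \<le> D a b + ennreal q"
      using jk unfolding j k by (intro add_left_mono) (simp add: prec_def)
    also have "\<dots> \<le> ennreal p" using ij unfolding i j by (simp add: prec_def)
    finally show "prec i k" by (simp add: prec_def i k)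
  next
    fix i j assume \<Lambda>: "i \<in> \<Lambda>" "j \<in> \<Lambda>"
    obtain a b p q where i: "i = (a, p)" and j: "j = (b, q)"
      by (cases i, cases j)
    define m where "m = min p q / 2"
    have "0 < p" "0 < q" using pos \<Lambda> unfolding i j by auto
    then have m: "0 < m" "m + m \<le> p" "m + m \<le> q" by (auto simp: m_def)
    obtain y r where y: "(y, r) \<in> Y" "r < m" "\<And>c. c \<in> {a, b} \<Longrightarrow> D c (y, r) \<le> ennreal m"
      by (rule directed_balls_0D[OF Y, of "{a, b}" m]) (use \<Lambda> m i j in \<open>auto simp: \<Lambda>_def\<close>)
    have "D c (y, r) + ennreal m \<le> ennreal m + ennreal m" if "c \<in> {a, b}" for c
      by (intro add_right_mono y that)
    moreover have "ennreal m + ennreal m \<le> ennreal p" "ennreal m + ennreal m \<le> ennreal q"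
      using m by (auto simp flip: ennreal_plus intro: ennreal_leI)
    ultimately have "prec i ((y, r), m)" "prec j ((y, r), m)"
      unfolding i j prec_def prod.case by (metis insertCI order_trans)+
    then show "\<exists>l\<in>\<Lambda>. prec i l \<and> prec j l"
      using y by (intro bexI[of _ "((y, r), m)"]) (auto simp: \<Lambda>_def)
  qed
  have ex_index: "\<exists>b. (b, e) \<in> \<Lambda> \<and> (\<forall>a\<in>F. D a b \<le> ennreal e)"
    if F: "finite F" "F \<subseteq> Y" "0 < e" for F e
  proof -
    obtain y r where "(y, r) \<in> Y" "r < e" "\<And>a. a \<in> F \<Longrightarrow> D a (y, r) \<le> ennreal e"
      by (rule directed_balls_0D[OF Y F]) blast
    then show ?thesis by (intro exI[of _ "(y, r)"]) (auto simp: \<Lambda>_def)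
  qed
  have "cauchy_net H \<Lambda> prec f"
    unfolding cauchy_net_iff
  proof (intro conjI net allI impI)
    fix e :: real assume e: "0 < e"
    obtain a0 where a0: "(a0, e/2) \<in> \<Lambda>" using ex_index[of "{}" "e/2"] e by auto
    have "H (f i) (f j) \<le> ennreal e"
      if \<Lambda>: "i \<in> \<Lambda>" "j \<in> \<Lambda>" and i0: "prec (a0, e/2) i" and ij: "prec i j" for i j
    proof -
      obtain y r p y' r' p' where i: "i = ((y, r), p)" and j: "j = ((y', r'), p')"
        by (metis surj_pair)
      have r: "0 \<le> r" "r < p" "p \<le> e/2"
        using pos \<Lambda>(1) precD(2)[OF i0[unfolded i] a0] unfolding i by (auto simp: \<Lambda>_def)
      have "H (f i) (f j) \<le> d y y'"
        using \<Lambda> in_E[OF Y] unfolding i j f_def by (auto simp: \<Lambda>_def intro!: H_ball_ideal_le)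
      also have "\<dots> \<le> d y y' + ennreal r'" by simp
      also have "\<dots> \<le> ennreal r + ennreal p"
        using precD(1)[OF ij[unfolded i j] \<Lambda>(1)[unfolded i]] by (simp add: ball_dist_le_iff)
      also have "\<dots> \<le> ennreal e"
        using r by (auto simp flip: ennreal_plus intro: ennreal_leI)
      finally show ?thesis .
    qed
    with a0 show "\<exists>i0\<in>\<Lambda>. \<forall>i\<in>\<Lambda>. \<forall>j\<in>\<Lambda>. prec i0 i \<longrightarrow> prec i j \<longrightarrow> H (f i) (f j) \<le> ennreal e"
      by blast
  qed
  moreover have "limitin (smyth_topology P H) f Y (tails \<Lambda> prec)"
  proof (rule hausdorff_smyth_limit[OF distance_D P_subset Y])
    have "f i \<in> P" if "i \<in> \<Lambda>" for i
      using that in_E[OF Y] by (auto simp: f_def \<Lambda>_def intro!: ball_ideal_in_P)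
    then show "\<forall>\<^sub>F i in tails \<Lambda> prec. f i \<in> P"
      using eventually_in_index[OF net] by (rule eventually_mono[rotated])
  next
    fix e :: real assume e: "0 < e"
    obtain a0 where a0: "(a0, e) \<in> \<Lambda>" using ex_index[of "{}" e] e by auto
    have "H (f i) Y \<le> ennreal e" if i\<Lambda>: "i \<in> \<Lambda>" and i0: "prec (a0, e) i" for i
    proof -
      obtain y r p where i: "i = ((y, r), p)" by (metis surj_pair)
      have "r < e" "(y, r) \<in> Y"
        using i\<Lambda> precD(2)[OF i0[unfolded i] a0] unfolding i by (auto simp: \<Lambda>_def)
      then show ?thesis
        using order_trans[OF H_ball_ideal_to[OF Y] ennreal_leI[of r e]] by (simp add: f_def i)
    qed
    then show "\<forall>\<^sub>F i in tails \<Lambda> prec. H (f i) Y \<le> ennreal e"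
      unfolding eventually_tails[OF net] using a0 by blast
  next
    fix a and e :: real assume a: "a \<in> Y" and e: "0 < e"
    obtain a0 where a0: "(a0, e/2) \<in> \<Lambda>" "D a a0 \<le> ennreal (e/2)"
      using ex_index[of "{a}" "e/2"] e a by auto
    have "(INF b\<in>f i. D a b) \<le> ennreal e" if i\<Lambda>: "i \<in> \<Lambda>" and i0: "prec (a0, e/2) i" for i
    proof -
      obtain y r p where i: "i = ((y, r), p)" by (metis surj_pair)
      have mem: "a \<in> E" "a0 \<in> E" "(y, r) \<in> E" "y \<in> X"
        using a a0 i\<Lambda> YE unfolding i by (auto simp: \<Lambda>_def formal_balls_def)
      have "(INF b\<in>f i. D a b) \<le> D a (y, r)"
        using dist_to_ball_ideal_le[OF mem(1,4)] by (simp add: f_def i)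
      also have "\<dots> \<le> D a a0 + D a0 (y, r)"
        by (rule distance_onD[OF distance_D mem(1,2,3)])
      also have "\<dots> \<le> ennreal (e/2) + ennreal (e/2)"
        by (intro add_mono a0 precD(1)[OF i0[unfolded i] a0(1)])
      finally show ?thesis by (simp add: ennreal_half_add[OF e])
    qed
    then show "\<forall>\<^sub>F i in tails \<Lambda> prec. (INF b\<in>f i. D a b) \<le> ennreal e"
      unfolding eventually_tails[OF net] using a0 by blast
  qed
  moreover have "f ` \<Lambda> \<subseteq> ball_ideal X d ` X"
    using in_E[OF Y] by (auto simp: f_def \<Lambda>_def)
  ultimately show "\<exists>(\<Lambda> :: (('a \<times> real) \<times> real) set) prec f. f ` \<Lambda> \<subseteq> ball_ideal X d ` X \<and>
      cauchy_net H \<Lambda> prec f \<and> limitin (smyth_topology P H) f Y (tails \<Lambda> prec)"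
    by blast
qed

text \<open>The set \<open>L\<close> of balls whose distance to \<open>Y l\<close> tends to \<open>0\<close> is the limit. If the tail of the
  net after \<open>l\<close> has diameter at most \<open>q\<close>, then every \<open>(x, r) \<in> Y l\<close> yields \<open>(x, r + q) \<in> L\<close>: the
  distance from \<open>(x, r)\<close> to later sets is at most about \<open>q\<close>, and the larger radius absorbs this.\<close>

lemma smyth_complete_P: "smyth_complete TYPE('j) P H"
  unfolding smyth_complete_def
proof (intro allI impI, elim conjE)
  fix \<Lambda> :: "'j set" and prec and Y :: "'j \<Rightarrow> ('a \<times> real) set"
  assume YP: "Y ` \<Lambda> \<subseteq> P" and cauchy: "cauchy_net H \<Lambda> prec Y"
  let ?F = "tails \<Lambda> prec"
  have net: "net_index \<Lambda> prec" using cauchy by (simp add: cauchy_net_def)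
  note ev_\<Lambda> = eventually_in_index[OF net]
  have small: "\<forall>\<^sub>F l in ?F. \<forall>k\<in>\<Lambda>. prec l k \<longrightarrow> H (Y l) (Y k) \<le> ennreal e" if "0 < e" for e
    using cauchy that unfolding cauchy_net_iff eventually_tails[OF net] by blast
  define L where "L = {a \<in> E. \<forall>e>0. \<forall>\<^sub>F l in ?F. (INF b\<in>Y l. D a b) \<le> ennreal e}"
  have enlarge: "(x, r + q) \<in> L"
    if l: "l \<in> \<Lambda>" and xr: "(x, r) \<in> Y l" and q: "0 < q"
      and sm: "\<forall>k\<in>\<Lambda>. prec l k \<longrightarrow> H (Y l) (Y k) \<le> ennreal q" for l x r q
  proof -
    have X: "x \<in> X" "0 \<le> r" using in_E YP l xr by blast+
    have "(INF b\<in>Y k. D (x, r + q) b) \<le> ennreal e" if k: "k \<in> \<Lambda>" "prec l k" and e: "0 < e" for k e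
    proof -
      obtain w t where w: "(w, t) \<in> Y k" "D (x, r) (w, t) \<le> ennreal q + ennreal e"
        using hausdorff_sup_approx[of D "Y l" "Y k" "ennreal q" e] sm k e xr by fastforce
      have "d x w + ennreal t \<le> ennreal (r + q) + ennreal e"
        using w(2) X q by (simp add: ball_dist_le_iff add.assoc)
      then have "D (x, r + q) (w, t) \<le> ennreal e" by (simp add: ball_dist_le_iff)
      then show ?thesis by (rule INF_lower2[OF w(1)])
    qed
    then show ?thesis
      using X q l by (auto simp: L_def formal_balls_def eventually_tails[OF net])
  qed
  have to_L: "\<forall>\<^sub>F l in ?F. H (Y l) L \<le> ennreal e" if e: "0 < e" for e
  proof -
    define q where "q = e / 3"
    have q: "0 < q" "ennreal q + ennreal q + ennreal q = ennreal e"
      using e by (auto simp: q_def simp flip: ennreal_plus)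
    show ?thesis using small[OF q(1)] ev_\<Lambda>
    proof eventually_elim
      case (elim l)
      \<comment> \<open>The witness in \<open>L\<close> is an enlarged ball of some later \<open>Y k\<close> that nearly attains
        \<open>H (Y l) (Y k)\<close>.\<close>
      have "\<forall>\<^sub>F k in ?F. prec l k" using elim by (auto simp: eventually_tails[OF net])
      with small[OF q(1)] ev_\<Lambda>
      have "\<forall>\<^sub>F k in ?F. (\<forall>j\<in>\<Lambda>. prec k j \<longrightarrow> H (Y k) (Y j) \<le> ennreal q) \<and> prec l k"
        by eventually_elim auto
      then obtain k where k: "k \<in> \<Lambda>" "prec l k" "\<forall>j\<in>\<Lambda>. prec k j \<longrightarrow> H (Y k) (Y j) \<le> ennreal q"
        using eventually_tails_ex[OF net] by blast
      obtain x r where xr: "(x, r) \<in> Y k" "\<And>b. b \<in> Y l \<Longrightarrow> D b (x, r) \<le> ennreal q + ennreal q"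
        using hausdorff_sup_approx[of D "Y l" "Y k" "ennreal q" q] elim k q by fastforce
      have r: "0 \<le> r" using in_E[of "Y k" x r] YP k xr by auto
      show ?case
      proof (rule hausdorff_sup_leI[OF enlarge[OF k(1) xr(1) q(1) k(3)]])
        fix b assume b: "b \<in> Y l"
        obtain c s where c: "b = (c, s)" by (cases b)
        have "d c x + ennreal (r + q) = (d c x + ennreal r) + ennreal q"
          using r q by (simp add: add.assoc)
        also have "\<dots> \<le> (ennreal s + (ennreal q + ennreal q)) + ennreal q"
          using xr(2)[OF b] unfolding c by (intro add_right_mono) (simp add: ball_dist_le_iff)
        also have "\<dots> = ennreal s + ennreal e" by (simp add: ac_simps flip: q(2))
        finally show "D b (x, r + q) \<le> ennreal e" by (simp add: c ball_dist_le_iff)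
      qed
    qed
  qed
  have LE: "L \<subseteq> E" by (auto simp: L_def)
  have YE: "Y l \<subseteq> E" if "l \<in> \<Lambda>" for l using that YP P_subset by auto
  \<comment> \<open>All of \<open>G\<close> is close to one \<open>Y l\<close>, and \<open>H (Y l) L\<close> small means that one ball of \<open>L\<close> serves
    all balls of \<open>Y l\<close>.\<close>
  have dir: "(INF y\<in>L. SUP z\<in>G. D z y) = 0" if G: "finite G" "G \<subseteq> L" for G
  proof -
    have "(INF y\<in>L. SUP z\<in>G. D z y) \<le> 0"
    proof (rule ennreal_le_epsilon)
      fix e :: real assume e: "0 < e"
      define q where "q = e / 4"
      have q: "0 < q" "(ennreal q + ennreal q) + (ennreal q + ennreal q) = ennreal e"
        using e by (auto simp: q_def simp flip: ennreal_plus)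
      have "\<forall>\<^sub>F l in ?F. \<forall>a\<in>G. (INF b\<in>Y l. D a b) \<le> ennreal q"
        using G q(1) by (intro eventually_ball_finite) (auto simp: L_def)
      with to_L[OF q(1)]
      have "\<forall>\<^sub>F l in ?F. H (Y l) L \<le> ennreal q \<and> (\<forall>a\<in>G. (INF b\<in>Y l. D a b) \<le> ennreal q)"
        by eventually_elim auto
      then obtain l where l: "l \<in> \<Lambda>" "H (Y l) L \<le> ennreal q"
          "\<And>a. a \<in> G \<Longrightarrow> (INF b\<in>Y l. D a b) \<le> ennreal q"
        using eventually_tails_ex[OF net] by blast
      obtain y where y: "y \<in> L" "\<And>b. b \<in> Y l \<Longrightarrow> D b y \<le> ennreal q + ennreal q"
        using hausdorff_sup_approx[OF l(2) _ q(1)] by auto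
      have "D a y \<le> ennreal e" if a: "a \<in> G" for a
      proof -
        obtain b where b: "b \<in> Y l" "D a b \<le> ennreal q + ennreal q"
          using INF_le_approx[OF l(3)[OF a] _ q(1)] by auto
        have "D a y \<le> D a b + D b y"
          using a G b(1) y(1) LE YE[OF l(1)] by (intro distance_onD[OF distance_D]) auto
        also have "\<dots> \<le> (ennreal q + ennreal q) + (ennreal q + ennreal q)"
          by (intro add_mono b y)
        finally show ?thesis by (simp only: q(2))
      qed
      then show "(INF y\<in>L. SUP z\<in>G. D z y) \<le> 0 + ennreal e"
        using y(1) by (auto intro!: INF_lower2 SUP_least)
    qed
    then show ?thesis by simp
  qed
  have "aperture L \<le> 0"
  proof (rule ennreal_le_epsilon)
    fix e :: real assume e: "0 < e"
    obtain l where l: "l \<in> \<Lambda>" "\<forall>k\<in>\<Lambda>. prec l k \<longrightarrow> H (Y l) (Y k) \<le> ennreal (e/2)"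
      using eventually_tails_ex[OF net small[of "e/2"]] e by auto
    obtain x r where xr: "(x, r) \<in> Y l" "r < e/2"
      by (rule directed_balls_0D[of "Y l" X d "{}" "e/2"]) (use YP l e in auto)
    have "(x, r + e/2) \<in> L" using e by (intro enlarge[OF l(1) xr(1) _ l(2)]) auto
    then show "aperture L \<le> 0 + ennreal e"
      unfolding aperture_def using xr by (intro INF_lower2) (auto intro: ennreal_leI)
  qed
  then have L: "L \<in> P"
    using LE dir by (auto simp: directed_balls_0_def directed_for_def)
  have "limitin (smyth_topology P H) Y L ?F"
  proof (rule hausdorff_smyth_limit[OF distance_D P_subset L])
    show "\<forall>\<^sub>F l in ?F. Y l \<in> P"
      using ev_\<Lambda> by eventually_elim (use YP in auto)
  qed (erule to_L, auto simp: L_def)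
  then show "\<exists>L\<in>P. limitin (smyth_topology P H) Y L ?F" by (rule bexI[OF _ L])
qed

lemma smyth_domain_P: "smyth_domain TYPE('j) TYPE(('a \<times> real) \<times> real) P H"
  unfolding smyth_domain_def
proof (intro conjI ballI smyth_complete_P)
  have "ball_ideal X d ` X \<subseteq> P" using ball_ideal_in_P by blast
  then show "smyth_continuous TYPE(('a \<times> real) \<times> real) P H"
    unfolding smyth_continuous_def by (rule smyth_basis_superset[OF ball_ideal_basis]) simp
next
  fix Y Z assume "Y \<in> P" "Z \<in> P"
  then show "upper_hemimetric P H Y Z \<le> lower_hemimetric P H Y Z"
    using hausdorff_upper_hemimetric_le[OF distance_D P_subset] by (simp add: lower_hemimetric_H_eq)
qed

end

theorem theorem6p1:
  fixes X :: "'a set" and d :: "'a \<Rightarrow> 'a \<Rightarrow> ennreal"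
  assumes "distance_on X d"
    and "smyth_continuous TYPE('i) X d"
  shows "(\<forall>Y\<in>directed_balls_0 X d. \<forall>Z\<in>directed_balls_0 X d.
            lower_hemimetric (directed_balls_0 X d) (hausdorff_sup (ball_dist d)) Y Z =
            hausdorff_sub (ball_dist d) Y Z) \<and>
         smyth_domain TYPE('j) TYPE(('a \<times> real) \<times> real)
            (directed_balls_0 X d) (hausdorff_sup (ball_dist d)) \<and>
         smyth_basis TYPE(('a \<times> real) \<times> real) (ball_ideal X d ` X)
            (directed_balls_0 X d) (hausdorff_sup (ball_dist d)) \<and>
         (\<forall>x\<in>X. \<forall>y\<in>X. hausdorff_sup (ball_dist d) (ball_ideal X d x) (ball_ideal X d y) \<le> d x y)"
proof -
  interpret approximable_distance X d
    by unfold_locales (rule assms(1), rule smyth_continuous_approx[OF assms(2)])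
  show ?thesis
    using lower_hemimetric_H_eq smyth_domain_P ball_ideal_basis H_ball_ideal_le by blast
qed

end
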